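(* Consider the contract game with compensation contract $\pi_i(y_1,\dots,y_n)=\delta_i-\gamma_i(\hat{x}-y_i)^2$. If, for all $i\in\{1,\dots,n\}$, $\lim_{a\to\infty}f_i(a)=\infty$ and $$\alpha_i\gamma_i\frac{(n-1)^2}{n^2}\eta''_i(a)+f''_i(a)>0\quad\text{for all }a\in\mathbb{R}_{\geq 0},$$ then there is a unique contract equilibrium.
   Context: There are $n$ sensors. Sensor $i$ chooses an effort $a_i\in\mathbb{R}_{\geq 0}$ and reports $y_i=x+w_i$, where $x\in\mathbb{R}$ is the unknown quantity being measured and, for each action tuple $(a_1,\dots,a_n)$, $w_i$ is a zero-mean random variable with variance $\mathbb{E}\{w_i^2\}=\eta_i(a_i)$, and $\mathbb{E}\{w_iw_j\}=0$ for $i\neq j$. Standing assumptions: $\eta_i:\mathbb{R}_{\geq 0}\to\mathbb{R}_{\geq 0}$ is twice continuously differentiable and strictly decreasing; $f_i:\mathbb{R}_{\geq 0}\to\mathbb{R}$ (cost of effort) is twice continuously differentiable and strictly increasing. Primes denote derivatives. The central planner uses the averaging estimate $\hat{x}=\frac1n(y_1+\dots+y_n)$ and pays sensor $i$ the compensation $p_i=\pi_i(y_1,\dots,y_n)=\delta_i-\gamma_i(\hat{x}-y_i)^2$, with constants $\gamma_i,\delta_i\in\mathbb{R}_{\geq 0}$. With $\alpha_i\in\mathbb{R}_{\geq 0}$ the value-of-compensation, the utility of sensor $i$ is $\bar{C}_i(a_i,a_{-i})=\alpha_i\mathbb{E}\{p_i\}-f_i(a_i)$, where $a_{-i}=(a_j)_{j\neq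 i}$. An action tuple $(a_i^* )_{i=1}^n\in\mathbb{R}_{\geq 0}^n$ is a contract equilibrium if $a_i^*\in\operatorname*{arg\,max}_{a_i\in\mathbb{R}_{\geq 0}}\bar{C}_i(a_i,a_{-i}^* )$ for all $i\in\{1,\dots,n\}$. *)

theory Defs
  imports "HOL-Probability.Probability"
begin

text \<open>
  The sensors are the elements of a finite type \<open>'n\<close>, so that \<open>n = CARD('n)\<close>, and tuples indexed
  by the sensors are vectors in \<open>real ^ 'n\<close>.
\<close>

subsection \<open>Derivatives on the nonnegative half-line\<close>

text \<open>
  Functions on the nonnegative reals are total functions on \<open>real\<close> whose values at negative
  arguments are irrelevant; accordingly, the derivative at \<open>0\<close> is the right-hand one.
\<close>

definition deriv_nonneg :: "(real \<Rightarrow> real) \<Rightarrow> real \<Rightarrow> real" where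
  "deriv_nonneg g a = vector_derivative g (at a within {0..})"

definition C2_nonneg :: "(real \<Rightarrow> real) \<Rightarrow> bool" where
  "C2_nonneg g \<longleftrightarrow>
     g differentiable_on {0..} \<and>
     deriv_nonneg g differentiable_on {0..} \<and>
     continuous_on {0..} (deriv_nonneg (deriv_nonneg g))"

subsection \<open>Measurements\<close>

definition nonneg_tuple :: "real ^ 'n \<Rightarrow> bool" where
  "nonneg_tuple a \<longleftrightarrow> (\<forall>i. 0 \<le> a $ i)"

text \<open>
  Both the probability space \<open>M a\<close> and the noise variables \<open>w a i\<close> on it may depend on the whole
  action tuple \<open>a\<close>; nothing relates the noise for different action tuples. Square integrability is
  part of having a variance, and it makes the products \<open>w a i \<cdot> w a j\<close> integrable.
\<close>

definition noise_model ::
  "(real ^ 'n \<Rightarrow> 'w measure) \<Rightarrow> (real ^ 'n \<Rightarrow> 'n \<Rightarrow> 'w \<Rightarrow> real) \<Rightarrow> ('n \<Rightarrow> real \<Rightarrow> real) \<Rightarrow> bool" where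
  "noise_model M w \<eta> \<longleftrightarrow>
     (\<forall>a. nonneg_tuple a \<longrightarrow>
        prob_space (M a) \<and>
        (\<forall>i. w a i \<in> borel_measurable (M a) \<and>
             integrable (M a) (\<lambda>\<omega>. (w a i \<omega>)\<^sup>2) \<and>
             integral\<^sup>L (M a) (w a i) = 0 \<and>
             integral\<^sup>L (M a) (\<lambda>\<omega>. (w a i \<omega>)\<^sup>2) = \<eta> i (a $ i)) \<and>
        (\<forall>i j. i \<noteq> j \<longrightarrow> integral\<^sup>L (M a) (\<lambda>\<omega>. w a i \<omega> * w a j \<omega>) = 0))"

definition reports :: "real \<Rightarrow> ('n::finite \<Rightarrow> 'w \<Rightarrow> real) \<Rightarrow> 'w \<Rightarrow> real ^ 'n" where
  "reports x v \<omega> = (\<chi> i. x + v i \<omega>)"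

subsection \<open>The contract game\<close>

definition average_estimate :: "real ^ 'n::finite \<Rightarrow> real" where
  "average_estimate y = (\<Sum>i\<in>UNIV. y $ i) / real CARD('n)"

definition quadratic_contract ::
  "real ^ 'n \<Rightarrow> real ^ 'n \<Rightarrow> 'n::finite \<Rightarrow> real ^ 'n \<Rightarrow> real" where
  "quadratic_contract \<delta> \<gamma> i y = \<delta> $ i - \<gamma> $ i * (average_estimate y - y $ i)\<^sup>2"

definition utility ::
  "(real ^ 'n \<Rightarrow> 'w measure) \<Rightarrow> (real ^ 'n \<Rightarrow> 'n \<Rightarrow> 'w \<Rightarrow> real) \<Rightarrow> real \<Rightarrow> real ^ 'n \<Rightarrow>
   ('n \<Rightarrow> real \<Rightarrow> real) \<Rightarrow> ('n \<Rightarrow> real ^ 'n \<Rightarrow> real) \<Rightarrow> 'n::finite \<Rightarrow> real ^ 'n \<Rightarrow> real" where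
  "utility M w x \<alpha> f \<pi> i a =
     \<alpha> $ i * integral\<^sup>L (M a) (\<lambda>\<omega>. \<pi> i (reports x (w a) \<omega>)) - f i (a $ i)"

definition change_action :: "real ^ 'n::finite \<Rightarrow> 'n \<Rightarrow> real \<Rightarrow> real ^ 'n" where
  "change_action a i b = (\<chi> j. if j = i then b else a $ j)"

definition contract_equilibrium ::
  "(real ^ 'n \<Rightarrow> 'w measure) \<Rightarrow> (real ^ 'n \<Rightarrow> 'n \<Rightarrow> 'w \<Rightarrow> real) \<Rightarrow> real \<Rightarrow> real ^ 'n \<Rightarrow>
   ('n \<Rightarrow> real \<Rightarrow> real) \<Rightarrow> ('n::finite \<Rightarrow> real ^ 'n \<Rightarrow> real) \<Rightarrow> real ^ 'n \<Rightarrow> bool" where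
  "contract_equilibrium M w x \<alpha> f \<pi> a \<longleftrightarrow>
     nonneg_tuple a \<and>
     (\<forall>i. is_arg_max (\<lambda>b. utility M w x \<alpha> f \<pi> i (change_action a i b)) (\<lambda>b. 0 \<le> b) (a $ i))"

end

theory Submission imports Defs begin

text \<open>
  The averaging residual of sensor \<open>i\<close> is a fixed linear combination of the noise variables, which
  are uncorrelated, so its second moment is a weighted sum of the variances \<open>\<eta> j (a $ j)\<close>
  (\<open>quadratic_contract_utility\<close>). No term of this sum mixes the actions of different sensors:
  the actions of the others shift the utility of sensor \<open>i\<close> by a constant, and the game decouples
  into separate minimisations, over \<open>b \<ge> 0\<close>, of the effective costs
  \<open>\<alpha>\<^sub>i \<gamma>\<^sub>i (n - 1)\<^sup>2 / n\<^sup>2 * \<eta>\<^sub>i b + f\<^sub>i b\<close> (\<open>contract_equilibrium_iff\<close>). Each effective cost is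
  continuous and tends to infinity, because it dominates \<open>f\<^sub>i\<close>, so it has a minimiser; its second
  derivative is positive, so it has only one (\<open>ex1_minimiser_nonneg\<close>). The unique equilibrium is
  the tuple of these minimisers.
\<close>

section \<open>Utilities under the quadratic contract\<close>

lemma integrable_mult_of_squares:
  fixes u v :: "'a \<Rightarrow> real"
  assumes [measurable]: "u \<in> borel_measurable M" "v \<in> borel_measurable M"
    and sq: "integrable M (\<lambda>\<omega>. (u \<omega>)\<^sup>2)" "integrable M (\<lambda>\<omega>. (v \<omega>)\<^sup>2)"
  shows "integrable M (\<lambda>\<omega>. u \<omega> * v \<omega>)"
proof (rule Bochner_Integration.integrable_bound)
  show "integrable M (\<lambda>\<omega>. (u \<omega>)\<^sup>2 + (v \<omega>)\<^sup>2)"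
    using sq by simp
  have "\<bar>p * q\<bar> \<le> p\<^sup>2 + q\<^sup>2" for p q :: real
  proof -
    have "2 * (\<bar>p\<bar> * \<bar>q\<bar>) \<le> p\<^sup>2 + q\<^sup>2"
      using sum_squares_bound[of "\<bar>p\<bar>" "\<bar>q\<bar>"] by (simp add: mult.assoc)
    moreover have "0 \<le> \<bar>p\<bar> * \<bar>q\<bar>" by simp
    ultimately show ?thesis unfolding abs_mult by linarith
  qed
  then show "AE \<omega> in M. norm (u \<omega> * v \<omega>) \<le> norm ((u \<omega>)\<^sup>2 + (v \<omega>)\<^sup>2)"
    by simp
qed simp

lemma uncorrelated_sum_second_moment:
  fixes v :: "'i::finite \<Rightarrow> 'a \<Rightarrow> real" and c :: "'i \<Rightarrow> real"
  assumes meas: "\<And>i. v i \<in> borel_measurable M"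
    and sq: "\<And>i. integrable M (\<lambda>\<omega>. (v i \<omega>)\<^sup>2)"
    and uncorr: "\<And>i j. i \<noteq> j \<Longrightarrow> integral\<^sup>L M (\<lambda>\<omega>. v i \<omega> * v j \<omega>) = 0"
  shows "integrable M (\<lambda>\<omega>. (\<Sum>i\<in>UNIV. c i * v i \<omega>)\<^sup>2)"
    and "integral\<^sup>L M (\<lambda>\<omega>. (\<Sum>i\<in>UNIV. c i * v i \<omega>)\<^sup>2)
      = (\<Sum>i\<in>UNIV. (c i)\<^sup>2 * integral\<^sup>L M (\<lambda>\<omega>. (v i \<omega>)\<^sup>2))"
proof -
  have expand: "(\<Sum>i\<in>UNIV. c i * v i \<omega>)\<^sup>2 = (\<Sum>i\<in>UNIV. \<Sum>j\<in>UNIV. c i * c j * (v i \<omega> * v j \<omega>))" for \<omega>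
    by (simp add: power2_eq_square sum_product mult_ac)
  have int: "integrable M (\<lambda>\<omega>. c i * c j * (v i \<omega> * v j \<omega>))" for i j
    using integrable_mult_of_squares[OF meas meas sq sq] by simp
  show "integrable M (\<lambda>\<omega>. (\<Sum>i\<in>UNIV. c i * v i \<omega>)\<^sup>2)"
    unfolding expand using int by (intro Bochner_Integration.integrable_sum)
  have moment: "integral\<^sup>L M (\<lambda>\<omega>. v i \<omega> * v j \<omega>)
      = (if j = i then integral\<^sup>L M (\<lambda>\<omega>. (v i \<omega>)\<^sup>2) else 0)" for i j
    using uncorr[of i j] by (auto simp: power2_eq_square)
  have "integral\<^sup>L M (\<lambda>\<omega>. (\<Sum>i\<in>UNIV. c i * v i \<omega>)\<^sup>2)
      = (\<Sum>i\<in>UNIV. \<Sum>j\<in>UNIV. c i * c j * integral\<^sup>L M (\<lambda>\<omega>. v i \<omega> * v j \<omega>))"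
    unfolding expand using int
    by (simp add: Bochner_Integration.integral_sum Bochner_Integration.integrable_sum)
  also have "\<dots> = (\<Sum>i\<in>UNIV. (c i)\<^sup>2 * integral\<^sup>L M (\<lambda>\<omega>. (v i \<omega>)\<^sup>2))"
    unfolding moment by (simp add: if_distrib power2_eq_square cong: if_cong)
  finally show "integral\<^sup>L M (\<lambda>\<omega>. (\<Sum>i\<in>UNIV. c i * v i \<omega>)\<^sup>2)
      = (\<Sum>i\<in>UNIV. (c i)\<^sup>2 * integral\<^sup>L M (\<lambda>\<omega>. (v i \<omega>)\<^sup>2))" .
qed

text \<open>
  The weights sum to \<open>0\<close>, so the unknown \<open>x\<close> cancels. In this form the residual is a linear
  combination of uncorrelated variables.
\<close>

lemma average_residual:
  fixes v :: "'n::finite \<Rightarrow> 'w \<Rightarrow> real"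
  shows "average_estimate (reports x v \<omega>) - reports x v \<omega> $ i
    = (\<Sum>j\<in>UNIV. (1 / real CARD('n) - of_bool (j = i)) * v j \<omega>)"
proof -
  have "(\<Sum>j\<in>UNIV. (1 / real CARD('n) - of_bool (j = i)) * v j \<omega>)
      = (\<Sum>j\<in>UNIV. v j \<omega>) / real CARD('n) - v i \<omega>"
    by (simp add: left_diff_distrib sum_subtractf sum_divide_distrib)
  then show ?thesis
    by (simp add: average_estimate_def reports_def sum.distrib add_divide_distrib)
qed

lemma quadratic_contract_utility:
  fixes M :: "real ^ 'n::finite \<Rightarrow> 'w measure"
  assumes noise: "noise_model M w \<eta>" and a: "nonneg_tuple a"
  shows "utility M w x \<alpha> f (quadratic_contract \<delta> \<gamma>) i a
    = \<alpha> $ i * (\<delta> $ i - \<gamma> $ i * (\<Sum>j\<in>UNIV. (1 / real CARD('n) - of_bool (j = i))\<^sup>2 * \<eta> j (a $ j)))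
      - f i (a $ i)"
proof -
  interpret prob_space "M a"
    using noise a unfolding noise_model_def by blast
  let ?c = "\<lambda>j. 1 / real CARD('n) - of_bool (j = i)"
  have w: "w a j \<in> borel_measurable (M a)" "integrable (M a) (\<lambda>\<omega>. (w a j \<omega>)\<^sup>2)"
    "integral\<^sup>L (M a) (\<lambda>\<omega>. (w a j \<omega>)\<^sup>2) = \<eta> j (a $ j)"
    "j \<noteq> k \<Longrightarrow> integral\<^sup>L (M a) (\<lambda>\<omega>. w a j \<omega> * w a k \<omega>) = 0" for j k
    using noise a unfolding noise_model_def by blast+
  have residual: "integrable (M a) (\<lambda>\<omega>. (\<Sum>j\<in>UNIV. ?c j * w a j \<omega>)\<^sup>2)"
    "integral\<^sup>L (M a) (\<lambda>\<omega>. (\<Sum>j\<in>UNIV. ?c j * w a j \<omega>)\<^sup>2) = (\<Sum>j\<in>UNIV. (?c j)\<^sup>2 * \<eta> j (a $ j))"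
    using uncorrelated_sum_second_moment[of "w a" "M a" ?c, OF w(1,2,4)] by (simp_all add: w(3))
  have "integral\<^sup>L (M a) (\<lambda>\<omega>. quadratic_contract \<delta> \<gamma> i (reports x (w a) \<omega>))
      = \<delta> $ i - \<gamma> $ i * integral\<^sup>L (M a) (\<lambda>\<omega>. (\<Sum>j\<in>UNIV. ?c j * w a j \<omega>)\<^sup>2)"
    unfolding quadratic_contract_def average_residual using residual(1) by (simp add: prob_space)
  also have "\<dots> = \<delta> $ i - \<gamma> $ i * (\<Sum>j\<in>UNIV. (?c j)\<^sup>2 * \<eta> j (a $ j))"
    unfolding residual(2) ..
  finally show ?thesis unfolding utility_def by simp
qed

text \<open>
  Among the weights of \<open>quadratic_contract_utility\<close>, the one belonging to sensor \<open>i\<close> itself is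
  \<open>(1 / n - 1)\<^sup>2 = (n - 1)\<^sup>2 / n\<^sup>2\<close>; all other summands are unaffected by a deviation of sensor \<open>i\<close>.
\<close>

lemma utility_change_action:
  fixes M :: "real ^ 'n::finite \<Rightarrow> 'w measure"
  assumes noise: "noise_model M w \<eta>" and a: "nonneg_tuple a"
  obtains K where "\<And>b. 0 \<le> b \<Longrightarrow>
    utility M w x \<alpha> f (quadratic_contract \<delta> \<gamma>) i (change_action a i b)
    = K - (\<alpha> $ i * \<gamma> $ i * ((real CARD('n) - 1)\<^sup>2 / (real CARD('n))\<^sup>2) * \<eta> i b + f i b)"
proof -
  define R where "R = (\<Sum>j\<in>UNIV - {i}. (1 / real CARD('n))\<^sup>2 * \<eta> j (a $ j))"
  have own: "(1 / real CARD('n) - 1)\<^sup>2 = (real CARD('n) - 1)\<^sup>2 / (real CARD('n))\<^sup>2"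
  proof -
    have "1 / real CARD('n) - 1 = (1 - real CARD('n)) / real CARD('n)"
      by (simp add: diff_divide_distrib)
    then show ?thesis by (simp add: power_divide power2_commute)
  qed
  have "utility M w x \<alpha> f (quadratic_contract \<delta> \<gamma>) i (change_action a i b)
      = \<alpha> $ i * (\<delta> $ i - \<gamma> $ i * R)
        - (\<alpha> $ i * \<gamma> $ i * ((real CARD('n) - 1)\<^sup>2 / (real CARD('n))\<^sup>2) * \<eta> i b + f i b)"
    if "0 \<le> b" for b
  proof -
    have "nonneg_tuple (change_action a i b)"
      using a that unfolding nonneg_tuple_def change_action_def by simp
    moreover have "(\<Sum>j\<in>UNIV. (1 / real CARD('n) - of_bool (j = i))\<^sup>2 * \<eta> j (change_action a i b $ j))
        = (real CARD('n) - 1)\<^sup>2 / (real CARD('n))\<^sup>2 * \<eta> i b + R"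
      unfolding R_def own[symmetric]
      by (subst sum.remove[of UNIV i]) (simp_all add: change_action_def)
    ultimately show ?thesis
      by (simp add: quadratic_contract_utility[OF noise] change_action_def algebra_simps)
  qed
  then show thesis by (rule that)
qed

lemma contract_equilibrium_iff:
  fixes M :: "real ^ 'n::finite \<Rightarrow> 'w measure"
    and \<alpha> \<gamma> \<delta> :: "real ^ 'n" and f :: "'n \<Rightarrow> real \<Rightarrow> real"
  assumes noise: "noise_model M w \<eta>"
  defines "g \<equiv> \<lambda>i b. \<alpha> $ i * \<gamma> $ i * ((real CARD('n) - 1)\<^sup>2 / (real CARD('n))\<^sup>2) * \<eta> i b + f i b"
  shows "contract_equilibrium M w x \<alpha> f (quadratic_contract \<delta> \<gamma>) a
    \<longleftrightarrow> (\<forall>i. 0 \<le> a $ i \<and> (\<forall>b\<ge>0. g i (a $ i) \<le> g i b))"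
proof (cases "nonneg_tuple a")
  case True
  have "is_arg_max (\<lambda>b. utility M w x \<alpha> f (quadratic_contract \<delta> \<gamma>) i (change_action a i b))
      (\<lambda>b. 0 \<le> b) (a $ i) \<longleftrightarrow> (\<forall>b\<ge>0. g i (a $ i) \<le> g i b)" for i
  proof -
    obtain K where "\<And>b. 0 \<le> b \<Longrightarrow>
        utility M w x \<alpha> f (quadratic_contract \<delta> \<gamma>) i (change_action a i b) = K - g i b"
      unfolding g_def by (rule utility_change_action[OF noise True, of x \<alpha> f \<delta> \<gamma> i]) blast
    moreover have "0 \<le> a $ i" using True unfolding nonneg_tuple_def by blast
    ultimately show ?thesis by (auto simp: is_arg_max_linorder)
  qed
  with True show ?thesis
    unfolding contract_equilibrium_def nonneg_tuple_def by blast
qed (auto simp: contract_equilibrium_def nonneg_tuple_def)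

section \<open>Minimisation of the effective cost\<close>

lemma C2_nonneg_has_derivs:
  assumes "C2_nonneg g" "0 \<le> a"
  shows "(g has_real_derivative deriv_nonneg g a) (at a within {0..})"
    and "(deriv_nonneg g has_real_derivative deriv_nonneg (deriv_nonneg g) a) (at a within {0..})"
  using assms
  by (auto simp: C2_nonneg_def differentiable_on_def deriv_nonneg_def vector_derivative_works
      has_real_derivative_iff_has_vector_derivative)

lemma coercive_attains_inf_nonneg:
  fixes g :: "real \<Rightarrow> real"
  assumes cont: "continuous_on {0..} g" and coercive: "filterlim g at_top at_top"
  shows "\<exists>p\<ge>0. \<forall>b\<ge>0. g p \<le> g b"
proof -
  obtain B where B: "\<And>b. B \<le> b \<Longrightarrow> g 0 \<le> g b"
    using coercive unfolding filterlim_at_top eventually_at_top_linorder by blast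
  have "\<exists>p\<in>{0..max 0 B}. \<forall>b\<in>{0..max 0 B}. g p \<le> g b"
    by (rule continuous_attains_inf) (auto intro: continuous_on_subset[OF cont])
  then obtain p where p: "0 \<le> p" "\<And>b. 0 \<le> b \<Longrightarrow> b \<le> max 0 B \<Longrightarrow> g p \<le> g b"
    by auto
  have "g p \<le> g b" if "0 \<le> b" for b
  proof (cases "b \<le> B")
    case True
    then show ?thesis using p(2)[of b] that by simp
  next
    case False
    have "g p \<le> g 0" by (rule p(2)) simp_all
    also have "\<dots> \<le> g b" using False by (intro B) simp
    finally show ?thesis .
  qed
  with p(1) show ?thesis by blast
qed

text \<open>
  The larger of two minimisers is an interior point, hence a critical point, and Rolle's theorem
  gives a further critical point strictly between the two. Rolle's theorem for \<open>g'\<close> then gives a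
  zero of \<open>g''\<close>, a contradiction. The smaller minimiser may be the boundary point \<open>0\<close>, where \<open>g'\<close>
  need not vanish; this is why Rolle's theorem is applied to \<open>g\<close> first.
\<close>

lemma minimiser_nonneg_le:
  fixes g :: "real \<Rightarrow> real"
  assumes deriv: "\<And>a. 0 \<le> a \<Longrightarrow> (g has_real_derivative g' a) (at a within {0..})"
    and deriv2: "\<And>a. 0 \<le> a \<Longrightarrow> (g' has_real_derivative g'' a) (at a within {0..})"
    and pos: "\<And>a. 0 \<le> a \<Longrightarrow> 0 < g'' a"
    and p: "0 \<le> p" "\<And>b. 0 \<le> b \<Longrightarrow> g p \<le> g b"
    and q: "0 \<le> q" "\<And>b. 0 \<le> b \<Longrightarrow> g q \<le> g b"
  shows "q \<le> p"
proof (rule ccontr)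
  assume "\<not> q \<le> p"
  then have less: "p < q" by simp
  have at: "at a within {0..} = at a" if "0 < a" for a :: real
    using that by (intro at_within_interior) simp
  have d: "DERIV g a :> g' a" "DERIV g' a :> g'' a" if "0 < a" for a
    using deriv[of a] deriv2[of a] that by (simp_all add: at)
  have cont: "continuous_on {0..} g" "continuous_on {0..} g'"
    using deriv deriv2 by (auto intro!: DERIV_continuous_on)
  have "g' q = 0"
  proof (rule DERIV_local_min[OF d(1)])
    show "0 < q" "0 < q" using less p(1) by simp_all
    show "\<forall>y. \<bar>q - y\<bar> < q \<longrightarrow> g q \<le> g y" using q(2) by auto
  qed
  moreover obtain z where z: "p < z" "z < q" "g' z = 0"
  proof -
    have "g p = g q" using p q by (simp add: antisym)
    moreover have "continuous_on {p..q} g"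
      using cont(1) p(1) by (auto intro: continuous_on_subset)
    moreover have "(g has_derivative (*) (g' a)) (at a)" if "p < a" for a
      using d(1)[of a] p(1) that by (simp add: has_field_derivative_def)
    ultimately obtain z where "p < z" "z < q" "(*) (g' z) = (\<lambda>v. 0)"
      using Rolle_deriv[OF less, of g "\<lambda>a. (*) (g' a)"] by blast
    then show thesis using that[of z] by (metis mult.right_neutral)
  qed
  ultimately have "g' z = g' q" by simp
  moreover have "continuous_on {z..q} g'"
    using cont(2) p(1) z(1) by (auto intro: continuous_on_subset)
  moreover have "(g' has_derivative (*) (g'' a)) (at a)" if "z < a" for a
    using d(2)[of a] p(1) z(1) that by (simp add: has_field_derivative_def)
  ultimately obtain u where "z < u" "u < q" "(*) (g'' u) = (\<lambda>v. 0)"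
    using Rolle_deriv[OF z(2), of g' "\<lambda>a. (*) (g'' a)"] by blast
  then have "g'' u = 0" "0 \<le> u" using p(1) z(1) by (metis mult.right_neutral, simp)
  with pos[of u] show False by simp
qed

lemma ex1_minimiser_nonneg:
  fixes g :: "real \<Rightarrow> real"
  assumes deriv: "\<And>a. 0 \<le> a \<Longrightarrow> (g has_real_derivative g' a) (at a within {0..})"
    and deriv2: "\<And>a. 0 \<le> a \<Longrightarrow> (g' has_real_derivative g'' a) (at a within {0..})"
    and pos: "\<And>a. 0 \<le> a \<Longrightarrow> 0 < g'' a"
    and coercive: "filterlim g at_top at_top"
  shows "\<exists>!p. 0 \<le> p \<and> (\<forall>b\<ge>0. g p \<le> g b)"
proof -
  have "continuous_on {0..} g" using deriv by (auto intro!: DERIV_continuous_on)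
  from coercive_attains_inf_nonneg[OF this coercive]
  obtain p where p: "0 \<le> p" "\<And>b. 0 \<le> b \<Longrightarrow> g p \<le> g b" by blast
  show ?thesis
  proof (rule ex1I)
    show "0 \<le> p \<and> (\<forall>b\<ge>0. g p \<le> g b)" using p by blast
    fix q
    assume "0 \<le> q \<and> (\<forall>b\<ge>0. g q \<le> g b)"
    then have q: "0 \<le> q" "\<And>b. 0 \<le> b \<Longrightarrow> g q \<le> g b" by blast+
    show "q = p"
      using minimiser_nonneg_le[OF deriv deriv2 pos p q] minimiser_nonneg_le[OF deriv deriv2 pos q p]
      by simp
  qed
qed

section \<open>Existence and uniqueness of the equilibrium\<close>

theorem proposition3:
  fixes M :: "real ^ 'n::finite \<Rightarrow> 'w measure"
    and w :: "real ^ 'n \<Rightarrow> 'n \<Rightarrow> 'w \<Rightarrow> real"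
    and x :: real
    and \<eta> f :: "'n \<Rightarrow> real \<Rightarrow> real"
    and \<alpha> \<gamma> \<delta> :: "real ^ 'n"
  assumes noise: "noise_model M w \<eta>"
    and eta_nonneg: "\<forall>i. \<forall>a\<ge>0. 0 \<le> \<eta> i a"
    and eta_C2: "\<forall>i. C2_nonneg (\<eta> i)"
    and eta_decreasing: "\<forall>i. strict_antimono_on {0..} (\<eta> i)"
    and f_C2: "\<forall>i. C2_nonneg (f i)"
    and f_increasing: "\<forall>i. strict_mono_on {0..} (f i)"
    and parameters: "nonneg_tuple \<alpha>" "nonneg_tuple \<gamma>" "nonneg_tuple \<delta>"
    and f_unbounded: "\<forall>i. filterlim (f i) at_top at_top"
    and second_order: "\<forall>i. \<forall>a\<ge>0.
      \<alpha> $ i * \<gamma> $ i * ((real CARD('n) - 1)\<^sup>2 / (real CARD('n))\<^sup>2)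
        * deriv_nonneg (deriv_nonneg (\<eta> i)) a
      + deriv_nonneg (deriv_nonneg (f i)) a > 0"
  shows "\<exists>!a. contract_equilibrium M w x \<alpha> f (quadratic_contract \<delta> \<gamma>) a"
proof -
  define \<kappa> where "\<kappa> i = \<alpha> $ i * \<gamma> $ i * ((real CARD('n) - 1)\<^sup>2 / (real CARD('n))\<^sup>2)" for i
  define minimises where
    "minimises i p \<longleftrightarrow> 0 \<le> p \<and> (\<forall>b\<ge>0. \<kappa> i * \<eta> i p + f i p \<le> \<kappa> i * \<eta> i b + f i b)" for i p
  have "\<exists>!p. minimises i p" for i
    unfolding minimises_def
  proof (rule ex1_minimiser_nonneg)
    show "((\<lambda>b. \<kappa> i * \<eta> i b + f i b) has_real_derivative
        \<kappa> i * deriv_nonneg (\<eta> i) a + deriv_nonneg (f i) a) (at a within {0..})"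
      and "((\<lambda>b. \<kappa> i * deriv_nonneg (\<eta> i) b + deriv_nonneg (f i) b) has_real_derivative
        \<kappa> i * deriv_nonneg (deriv_nonneg (\<eta> i)) a + deriv_nonneg (deriv_nonneg (f i)) a)
        (at a within {0..})"
      if "0 \<le> a" for a
      using eta_C2 f_C2 that by (auto intro!: DERIV_add DERIV_cmult C2_nonneg_has_derivs)
    show "0 < \<kappa> i * deriv_nonneg (deriv_nonneg (\<eta> i)) a + deriv_nonneg (deriv_nonneg (f i)) a"
      if "0 \<le> a" for a
      using second_order that unfolding \<kappa>_def by blast
    have "0 \<le> \<kappa> i"
      using parameters unfolding \<kappa>_def nonneg_tuple_def by simp
    then have "f i b \<le> \<kappa> i * \<eta> i b + f i b" if "0 \<le> b" for b
      using eta_nonneg that by simp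
    then have "\<forall>\<^sub>F b in at_top. f i b \<le> \<kappa> i * \<eta> i b + f i b"
      using eventually_ge_at_top[of 0] by (rule eventually_mono[rotated])
    with f_unbounded show "filterlim (\<lambda>b. \<kappa> i * \<eta> i b + f i b) at_top at_top"
      by (blast intro: filterlim_at_top_mono)
  qed
  then obtain m where m: "minimises i p \<longleftrightarrow> p = m i" for i p
    by metis
  have "contract_equilibrium M w x \<alpha> f (quadratic_contract \<delta> \<gamma>) a \<longleftrightarrow> (\<forall>i. minimises i (a $ i))" for a
    unfolding contract_equilibrium_iff[OF noise] minimises_def \<kappa>_def ..
  then have "contract_equilibrium M w x \<alpha> f (quadratic_contract \<delta> \<gamma>) a \<longleftrightarrow> a = (\<chi> i. m i)" for a
    unfolding m by (simp add: vec_eq_iff)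
  then show ?thesis by simp
qed

end
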